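(* Let $\mathcal{G}=(G,\theta)$ be a valued digraph, $G=(V,E)$, and let $\mu$ be the Möbius function of the poset $(IS(\mathcal{G}),\subseteq)$. For $A\in IS(\mathcal{G})$ let $\mathcal{N}(A)=\{x\in A:\theta(x)=0\}$ and $\mathcal{F}(A)=\{x\in A: A\setminus\{x\}\in IS(\mathcal{G})\}$. If $\mathcal{F}(A)=\mathcal{N}(A)$, then $\mu(\emptyset,A)=(-1)^{|\mathcal{N}(A)|}$; otherwise $\mu(\emptyset,A)=0$.
   Context: A simple digraph is a pair $G=(V,E)$ with $E\subseteq V\times V$; it is acyclic if it has no directed cycle. The out-degree is $d^+(x)=|\{y:(x,y)\in E\}|$. A valued digraph is a pair $(G,\theta)$ with $G$ simple acyclic and $\theta:V\to\mathbb{N}$ with $0\le\theta(x)\le d^+(x)$. A vertex $x$ is erasable if $\theta(x)=0$ and every $z$ with $(z,x)\in E$ has $\theta(z)\ne0$. Peeling process: starting from $\mathcal{G}_1=\mathcal{G}$, as long as $\mathcal{G}_i=(G_i,\theta_i)$ has an erasable vertex, choose one, $x_i$, delete it with its incident arcs to get $G_{i+1}$, and set $\theta_{i+1}(y)=\theta_i(y)-1$ if $(y,x_i)$ is an arc of $G_i$, $\theta_{i+1}(y)=\theta_i(y)$ otherwise. The resulting sequences $[x_1,x_2,\dots]$ are the peeling sequences. $IS(\mathcal{G})$ is the set consisting of $\emptyset$ and all sets $\{x_1,\dots,x_k\}$, $k\ge1$, for peeling sequences $[x_1,x_2,\dots]$. *)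

theory Defs
  imports "Graph_Theory.Pair_Digraph" "HOL-Library.Extended_Nat"
begin

section \<open>Valued digraphs\<close>

type_synonym 'a valued_digraph = "'a pair_pre_digraph \<times> ('a \<Rightarrow> nat)"

text \<open>
  The vertex set is not assumed finite. A vertex of infinite out-degree puts no upper bound
  on its value; the finiteness guard is needed because \<^const>\<open>out_degree\<close> is then 0.
  Values outside the vertex set are never inspected.
\<close>

fun is_valued_digraph :: "'a valued_digraph \<Rightarrow> bool" where
  "is_valued_digraph (G, \<theta>) \<longleftrightarrow>
     pair_wf_digraph G \<and> acyclic (parcs G) \<and>
     (\<forall>x\<in>pverts G. finite (out_arcs (with_proj G) x) \<longrightarrow> \<theta> x \<le> out_degree (with_proj G) x)"

fun erasable :: "'a valued_digraph \<Rightarrow> 'a \<Rightarrow> bool" where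
  "erasable (G, \<theta>) x \<longleftrightarrow>
     x \<in> pverts G \<and> \<theta> x = 0 \<and> (\<forall>z. (z, x) \<in> parcs G \<longrightarrow> \<theta> z \<noteq> 0)"

text \<open>
  When \<open>x\<close> is erasable, every \<open>y\<close> with an arc to \<open>x\<close> has a positive value, so the
  subtraction below does not truncate.
\<close>

fun peel :: "'a valued_digraph \<Rightarrow> 'a \<Rightarrow> 'a valued_digraph" where
  "peel (G, \<theta>) x =
     (\<lparr> pverts = pverts G - {x}, parcs = {e \<in> parcs G. fst e \<noteq> x \<and> snd e \<noteq> x} \<rparr>,
      \<lambda>y. if (y, x) \<in> parcs G then \<theta> y - 1 else \<theta> y)"

primrec peel_upto :: "'a valued_digraph \<Rightarrow> (nat \<Rightarrow> 'a) \<Rightarrow> nat \<Rightarrow> 'a valued_digraph" where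
  "peel_upto \<G> x 0 = \<G>"
| "peel_upto \<G> x (Suc i) = peel (peel_upto \<G> x i) (x i)"

text \<open>
  A peeling sequence has length \<open>n\<close>, possibly infinite, and consists of the entries \<open>x i\<close>
  with \<open>i < n\<close> (indexed from 0). The process stops only when no erasable vertex is left.
\<close>

definition peeling_sequence :: "'a valued_digraph \<Rightarrow> enat \<Rightarrow> (nat \<Rightarrow> 'a) \<Rightarrow> bool" where
  "peeling_sequence \<G> n x \<longleftrightarrow>
     (\<forall>i. enat i < n \<longrightarrow> erasable (peel_upto \<G> x i) (x i)) \<and>
     (\<forall>i. enat i = n \<longrightarrow> \<not> (\<exists>v. erasable (peel_upto \<G> x i) v))"

definition IS :: "'a valued_digraph \<Rightarrow> 'a set set" where
  "IS \<G> = {{}} \<union> {x ` {..<k} | x k n. peeling_sequence \<G> n x \<and> 1 \<le> k \<and> enat k \<le> n}"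

definition zero_vertices :: "'a valued_digraph \<Rightarrow> 'a set \<Rightarrow> 'a set" where
  "zero_vertices \<G> A = {x \<in> A. snd \<G> x = 0}"

definition free_vertices :: "'a valued_digraph \<Rightarrow> 'a set \<Rightarrow> 'a set" where
  "free_vertices \<G> A = {x \<in> A. A - {x} \<in> IS \<G>}"

section \<open>The Moebius function of a locally finite poset\<close>

text \<open>
  The poset is the set \<open>P\<close> with the order induced from the ambient type. The value is 0 by
  convention if \<open>x \<le> y\<close> fails in \<open>P\<close> or the interval from \<open>x\<close> to \<open>y\<close> in \<open>P\<close> is infinite.
\<close>

function moebius :: "'b::order set \<Rightarrow> 'b \<Rightarrow> 'b \<Rightarrow> int" where
  "moebius P x y =
     (if x \<in> P \<and> y \<in> P \<and> x \<le> y \<and> finite {z \<in> P. x \<le> z \<and> z \<le> y}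
      then if x = y then 1 else - (\<Sum>z\<in>{z \<in> P. x \<le> z \<and> z < y}. moebius P x z)
      else 0)"
  by pat_completeness auto
termination
proof (relation "measure (\<lambda>(P, x, y). card {z \<in> P. x \<le> z \<and> z \<le> y})", goal_cases)
  case 1
  then show ?case by simp
next
  case (2 P x y z)
  have "{w \<in> P. x \<le> w \<and> w \<le> z} \<subset> {w \<in> P. x \<le> w \<and> w \<le> y}"
    using 2 by (auto simp: less_le_not_le intro: order_trans)
  with 2 show ?case by (simp add: psubset_card_mono)
qed

declare moebius.simps [simp del]

lemma moebius_refl: "x \<in> P \<Longrightarrow> moebius P x x = 1"
proof -
  assume "x \<in> P"
  moreover have "{z \<in> P. x \<le> z \<and> z \<le> x} \<subseteq> {x}" by auto
  then have "finite {z \<in> P. x \<le> z \<and> z \<le> x}" by (rule finite_subset) simp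
  ultimately show ?thesis by (simp add: moebius.simps)
qed

lemma moebius_sum_eq_0:
  assumes "x \<in> P" "y \<in> P" "x < y" and fin: "finite {z \<in> P. x \<le> z \<and> z \<le> y}"
  shows "(\<Sum>z\<in>{z \<in> P. x \<le> z \<and> z \<le> y}. moebius P x z) = 0"
proof -
  have eq: "{z \<in> P. x \<le> z \<and> z \<le> y} = insert y {z \<in> P. x \<le> z \<and> z < y}"
    using assms by (auto simp: order.order_iff_strict)
  have "finite {z \<in> P. x \<le> z \<and> z < y}"
    using fin unfolding eq by simp
  moreover have "moebius P x y = - (\<Sum>z\<in>{z \<in> P. x \<le> z \<and> z < y}. moebius P x z)"
    using assms by (subst moebius.simps) auto
  ultimately show ?thesis unfolding eq by simp
qed

lemma finite_IS_interval:
  assumes "B \<in> IS \<G>"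
  shows "finite {C \<in> IS \<G>. A \<subseteq> C \<and> C \<subseteq> B}"
proof (rule finite_subset)
  show "{C \<in> IS \<G>. A \<subseteq> C \<and> C \<subseteq> B} \<subseteq> Pow B" by auto
  show "finite (Pow B)" using assms by (auto simp: IS_def)
qed

end

theory Submission
  imports Defs
begin

text \<open>
  Call a finite \<open>B\<close> balanced if every \<open>z\<close> in \<open>B\<close> has at least \<open>\<theta> z\<close> out-neighbours in \<open>B\<close>,
  and every \<open>z\<close> outside \<open>B\<close> at most \<open>\<theta> z\<close>. By acyclicity the balanced sets are exactly
  the elements of the poset. Every set \<open>X\<close> of atoms below \<open>A\<close> has a least balanced superset, and it
  equals \<open>B\<close> iff \<open>X\<close> lies between the free vertices of \<open>B\<close> and the atoms below \<open>B\<close>. The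
  alternating sum over such \<open>X\<close> therefore satisfies the recursion of \<open>\<mu>({}, B)\<close>, and it vanishes
  unless the free vertices of \<open>B\<close> are its atoms, which happens exactly when they are its
  vertices of value 0.
\<close>

section \<open>Extremal vertices and alternating sums\<close>

lemma finite_acyclic_source:
  assumes "acyclic r" "finite T" "T \<noteq> {}"
  obtains x where "x \<in> T" "\<And>z. z \<in> T \<Longrightarrow> (z, x) \<notin> r"
proof -
  have "acyclic (r \<inter> T \<times> T)"
    using assms(1) by (rule acyclic_subset) blast
  then have "wf (r \<inter> T \<times> T)"
    using assms(2) by (intro finite_acyclic_wf) auto
  then obtain x where "x \<in> T" "\<forall>z. (z, x) \<in> r \<inter> T \<times> T \<longrightarrow> z \<notin> T"
    using assms(3) unfolding wf_eq_minimal by (metis ex_in_conv)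
  then show thesis
    using that by blast
qed

lemma finite_acyclic_sink:
  assumes "acyclic r" "finite T" "T \<noteq> {}"
  obtains x where "x \<in> T" "\<And>z. z \<in> T \<Longrightarrow> (x, z) \<notin> r"
  using finite_acyclic_source[of "r\<inverse>" T] assms by (auto simp: acyclic_converse)

text \<open>Toggling a fixed element of \<open>U - F\<close> pairs even sets with odd ones; if
  \<open>F\<close> is not contained in \<open>U\<close>, the sum is empty.\<close>

lemma sum_alternating_interval:
  assumes "finite U"
  shows "(\<Sum>X | F \<subseteq> X \<and> X \<subseteq> U. (-1) ^ card X) =
    (if F = U then (-1) ^ card U else (0 :: int))"
proof -
  consider "F = U" | "F \<subset> U" | "\<not> F \<subseteq> U"
    by blast
  then show ?thesis
  proof cases
    case 1
    then have "{X. F \<subseteq> X \<and> X \<subseteq> U} = {U}"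
      by auto
    then show ?thesis
      using 1 by simp
  next
    case 2
    have "finite {X. F \<subseteq> X \<and> X \<subseteq> U}"
      using assms by (auto intro: finite_subset[of _ "Pow U"])
    moreover have "card {X. X \<subseteq> U \<and> F \<subseteq> X \<and> even (card X)} =
        card {X. X \<subseteq> U \<and> F \<subseteq> X \<and> odd (card X)}"
      using card_subsupersets_even_odd[OF assms 2] .
    ultimately show ?thesis
      using 2 by (simp add: sum_alternating_cancels conj_ac)
  next
    case 3
    then have "{X. F \<subseteq> X \<and> X \<subseteq> U} = {}" "F \<noteq> U"
      by blast+
    then show ?thesis
      by (simp only: sum.empty if_False)
  qed
qed

section \<open>Prefixes of peeling sequences\<close>

lemma peel_upto_cong:
  "(\<And>j. j < i \<Longrightarrow> x j = y j) \<Longrightarrow> peel_upto \<G> x i = peel_upto \<G> y i"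
  by (induction i) auto

text \<open>\<open>IS\<close> only uses prefixes of runs that cannot be continued, so a finite run
  has to be prolonged: erasable vertices are chosen for as long as there are any.\<close>

lemma peeling_sequence_extension:
  assumes "\<And>i. i < k \<Longrightarrow> erasable (peel_upto \<G> x i) (x i)"
  shows "\<exists>y n. peeling_sequence \<G> n y \<and> enat k \<le> n \<and> (\<forall>i<k. y i = x i)"
proof -
  define next_vertex where "next_vertex i \<H> = (if i < k then x i else SOME v. erasable \<H> v)" for i \<H>
  define state where "state = rec_nat \<G> (\<lambda>i \<H>. peel \<H> (next_vertex i \<H>))"
  define y where "y i = next_vertex i (state i)" for i
  \<comment> \<open>The length will be the first stuck stage, or infinite if there is none; stages
    before \<open>k\<close> are excluded so that it is at least \<open>k\<close>.\<close>
  define stuck where "stuck i \<longleftrightarrow> k \<le> i \<and> (\<nexists>v. erasable (state i) v)" for i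
  define n where "n = (if \<exists>i. stuck i then enat (LEAST i. stuck i) else \<infinity>)"
  have state: "peel_upto \<G> y i = state i" for i
    by (induction i) (simp_all add: state_def y_def)
  have y_init: "y i = x i" if "i < k" for i
    using that by (simp add: y_def next_vertex_def)
  have le: "enat k \<le> n"
    using LeastI_ex[of stuck] by (auto simp: n_def stuck_def[of "Least stuck"])
  have step: "erasable (state i) (y i)" if "enat i < n" for i
  proof (cases "i < k")
    case True
    then have "state i = peel_upto \<G> x i"
      unfolding state[symmetric] by (intro peel_upto_cong y_init) simp
    then show ?thesis
      using assms[OF True] y_init[OF True] by simp
  next
    case False
    have "\<not> stuck i"
      using that by (auto simp: n_def split: if_splits dest: not_less_Least)
    then have "\<exists>v. erasable (state i) v"
      using False by (simp add: stuck_def)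
    then show ?thesis
      using False by (simp add: y_def next_vertex_def someI_ex)
  qed
  have "\<nexists>v. erasable (state i) v" if "enat i = n" for i
  proof -
    have "stuck i"
      using that LeastI_ex[of stuck] by (auto simp: n_def split: if_splits)
    then show ?thesis
      by (simp add: stuck_def)
  qed
  then have "peeling_sequence \<G> n y"
    using step by (simp add: peeling_sequence_def state)
  then show ?thesis
    using le y_init by blast
qed

section \<open>Balanced sets\<close>

locale acyclic_valued_digraph =
  fixes G :: "'a pair_pre_digraph" and \<theta> :: "'a \<Rightarrow> nat"
  assumes acyclic: "acyclic (parcs G)"
begin

definition out_count :: "'a set \<Rightarrow> 'a \<Rightarrow> nat" where
  "out_count B z = card {y \<in> B. (z, y) \<in> parcs G}"

text \<open>When \<open>B\<close> has been peeled, exactly \<open>\<theta> z\<close> out-neighbours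
  of \<open>z \<in> B\<close> went before \<open>z\<close>, whence the lower bound; the value left
  at \<open>z \<notin> B\<close> is \<open>\<theta> z - out_count B z\<close>, whence the upper
  bound.\<close>

definition balanced :: "'a set \<Rightarrow> bool" where
  "balanced B \<longleftrightarrow> finite B \<and> B \<subseteq> pverts G \<and>
     (\<forall>z\<in>B. \<theta> z \<le> out_count B z) \<and> (\<forall>z. z \<notin> B \<longrightarrow> out_count B z \<le> \<theta> z)"

lemma no_loop: "(z, z) \<notin> parcs G"
  using acyclic by (auto simp: acyclic_def)

lemma out_count_insert:
  assumes "finite B" "x \<notin> B"
  shows "out_count (insert x B) z = (if (z, x) \<in> parcs G then Suc (out_count B z) else out_count B z)"
proof -
  have "{y \<in> insert x B. (z, y) \<in> parcs G} =
    (if (z, x) \<in> parcs G then insert x {y \<in> B. (z, y) \<in> parcs G} else {y \<in> B. (z, y) \<in> parcs G})"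
    by auto
  then show ?thesis
    using assms by (simp add: out_count_def)
qed

lemma out_count_remove:
  assumes "finite B" "x \<in> B"
  shows "out_count B z = (if (z, x) \<in> parcs G then Suc (out_count (B - {x}) z) else out_count (B - {x}) z)"
  using out_count_insert[of "B - {x}" x z] assms by (metis insert_Diff finite_Diff Diff_iff singletonI)

lemma out_count_mono: "finite C \<Longrightarrow> B \<subseteq> C \<Longrightarrow> out_count B z \<le> out_count C z"
  unfolding out_count_def by (intro card_mono) auto

lemma out_count_eq_0_iff: "finite B \<Longrightarrow> out_count B z = 0 \<longleftrightarrow> (\<forall>y\<in>B. (z, y) \<notin> parcs G)"
  by (auto simp: out_count_def)

lemma balanced_empty: "balanced {}"
  by (simp add: balanced_def out_count_def)

lemma balanced_insert:
  assumes "balanced B" "x \<in> pverts G" "x \<notin> B" "out_count B x = \<theta> x"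
    and "\<And>z. z \<notin> B \<Longrightarrow> (z, x) \<in> parcs G \<Longrightarrow> out_count B z < \<theta> z"
  shows "balanced (insert x B)"
proof -
  have fin: "finite B"
    using assms(1) by (simp add: balanced_def)
  show ?thesis
    using assms by (auto simp: balanced_def out_count_insert[OF fin assms(3)] no_loop le_SucI Suc_leI)
qed

text \<open>Deleting \<open>x\<close> lowers the counts of its in-neighbours by one, so those inside
  \<open>B\<close> need slack. Without loops \<open>x\<close> keeps its count, but it must now obey
  the upper bound, which turns its lower bound into an equality.\<close>

lemma balanced_remove_iff:
  assumes "balanced B" "x \<in> B"
  shows "balanced (B - {x}) \<longleftrightarrow>
    out_count B x = \<theta> x \<and> (\<forall>z\<in>B. (z, x) \<in> parcs G \<longrightarrow> \<theta> z < out_count B z)"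
proof -
  have fin: "finite B"
    using assms(1) by (simp add: balanced_def)
  have "\<theta> x \<le> out_count B x"
    using assms by (simp add: balanced_def)
  then show ?thesis
    using assms no_loop[of x] fin unfolding balanced_def
    by (auto simp: out_count_remove[OF fin assms(2)] less_Suc_eq_le split: if_splits)
qed

text \<open>
  A removable vertex outside \<open>B\<close> is a source among the vertices of \<open>C - B\<close> at which the
  balance inequality of \<open>C\<close> is an equality; any sink of \<open>C - B\<close> shows that there are some.
\<close>

lemma balanced_subset_removable:
  assumes "balanced B" "balanced C" "B \<subset> C"
  obtains x where "x \<in> C - B" "balanced (C - {x})"
proof -
  have fin: "finite C"
    using assms(2) by (simp add: balanced_def)
  define T where "T = {x \<in> C - B. out_count C x = \<theta> x}"
  obtain s where s: "s \<in> C - B" "\<And>z. z \<in> C - B \<Longrightarrow> (s, z) \<notin> parcs G"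
    using finite_acyclic_sink[OF acyclic, of "C - B"] fin assms(3) by auto
  have "{y \<in> C. (s, y) \<in> parcs G} = {y \<in> B. (s, y) \<in> parcs G}"
    using s assms(3) by blast
  then have "out_count C s \<le> \<theta> s"
    using assms(1) s(1) by (simp add: balanced_def out_count_def)
  then have "s \<in> T"
    using s(1) assms(2) by (simp add: T_def balanced_def le_antisym)
  then obtain x where x: "x \<in> T" "\<And>z. z \<in> T \<Longrightarrow> (z, x) \<notin> parcs G"
    using finite_acyclic_source[OF acyclic, of T] fin by (auto simp: T_def)
  have "\<theta> z < out_count C z" if z: "z \<in> C" "(z, x) \<in> parcs G" for z
  proof (cases "z \<in> B")
    case True
    have "\<theta> z \<le> out_count B z"
      using assms(1) True by (simp add: balanced_def)
    \<comment> \<open>Strict because \<open>x \<in> C - B\<close> is itself an out-neighbour of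
      \<open>z\<close>.\<close>
    also have "\<dots> < out_count C z"
      unfolding out_count_def
      using fin assms(3) x(1) z(2) by (intro psubset_card_mono) (auto simp: T_def)
    finally show ?thesis .
  next
    case False
    then have "out_count C z \<noteq> \<theta> z"
      using x(2) z by (auto simp: T_def)
    then show ?thesis
      using assms(2) z(1) by (simp add: balanced_def order_less_le)
  qed
  then have "balanced (C - {x})"
    using x(1) assms(2) by (subst balanced_remove_iff) (auto simp: T_def)
  then show thesis
    using that x(1) by (auto simp: T_def)
qed

section \<open>Balanced sets as peeled sets\<close>

lemma peel_upto_state:
  assumes "\<And>j. j < i \<Longrightarrow> erasable (peel_upto (G, \<theta>) x j) (x j)"
  shows "pverts (fst (peel_upto (G, \<theta>) x i)) = pverts G - x ` {..<i} \<and>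
    parcs (fst (peel_upto (G, \<theta>) x i)) =
      {e \<in> parcs G. fst e \<notin> x ` {..<i} \<and> snd e \<notin> x ` {..<i}} \<and>
    (\<forall>z. z \<notin> x ` {..<i} \<longrightarrow> snd (peel_upto (G, \<theta>) x i) z + out_count (x ` {..<i}) z = \<theta> z)"
  using assms
proof (induction i)
  case 0
  then show ?case by (simp add: out_count_def)
next
  case (Suc i)
  obtain H \<eta> where H: "peel_upto (G, \<theta>) x i = (H, \<eta>)"
    by fastforce
  let ?S = "x ` {..<i}"
  have IH: "pverts H = pverts G - ?S"
    "parcs H = {e \<in> parcs G. fst e \<notin> ?S \<and> snd e \<notin> ?S}"
    "\<And>z. z \<notin> ?S \<Longrightarrow> \<eta> z + out_count ?S z = \<theta> z"
    using Suc H by auto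
  have er: "x i \<in> pverts H" "\<And>z. (z, x i) \<in> parcs H \<Longrightarrow> \<eta> z \<noteq> 0"
    using Suc.prems[of i] H by auto
  have new: "x i \<notin> ?S"
    using er(1) IH(1) by auto
  have S: "x ` {..<Suc i} = insert (x i) ?S"
    by (simp add: lessThan_Suc)
  \<comment> \<open>By \<open>er\<close> the subtraction in \<open>peel\<close> does not truncate.
    Only unpeeled \<open>z\<close> qualify: the value of a peeled vertex is frozen, while its count
    may still grow.\<close>
  have "snd (peel (H, \<eta>) (x i)) z + out_count (insert (x i) ?S) z = \<theta> z" if "z \<notin> insert (x i) ?S" for z
    using IH(2) IH(3)[of z] er(2)[of z] that new by (auto simp: out_count_insert)
  then show ?case
    unfolding S by (auto simp: H IH(1,2))
qed

text \<open>Erasability depends only on the set peeled so far, not on its order: a current value is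
  0 iff the count has reached \<open>\<theta>\<close>.\<close>

lemma erasable_peel_upto_iff:
  assumes "\<And>j. j < i \<Longrightarrow> erasable (peel_upto (G, \<theta>) x j) (x j)"
  shows "erasable (peel_upto (G, \<theta>) x i) v \<longleftrightarrow>
    v \<in> pverts G \<and> v \<notin> x ` {..<i} \<and> \<theta> v = out_count (x ` {..<i}) v \<and>
    (\<forall>z. z \<notin> x ` {..<i} \<longrightarrow> (z, v) \<in> parcs G \<longrightarrow> \<theta> z \<noteq> out_count (x ` {..<i}) z)"
proof -
  obtain H \<eta> where H: "peel_upto (G, \<theta>) x i = (H, \<eta>)"
    by fastforce
  let ?S = "x ` {..<i}"
  have "pverts H = pverts G - ?S"
    "parcs H = {e \<in> parcs G. fst e \<notin> ?S \<and> snd e \<notin> ?S}"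
    and val: "\<And>z. z \<notin> ?S \<Longrightarrow> \<eta> z + out_count ?S z = \<theta> z"
    using peel_upto_state[of i x] assms H by auto
  moreover have "\<eta> z = 0 \<longleftrightarrow> \<theta> z = out_count ?S z" if "z \<notin> ?S" for z
    using val[OF that] by linarith
  ultimately show ?thesis
    unfolding H by auto
qed

text \<open>Erasability supplies the premises of \<open>balanced_insert\<close>, since balance
  sharpens its disequalities to strict inequalities.\<close>

lemma balanced_peeled:
  assumes "\<And>j. j < i \<Longrightarrow> erasable (peel_upto (G, \<theta>) x j) (x j)"
  shows "balanced (x ` {..<i})"
  using assms
proof (induction i)
  case 0
  then show ?case by (simp add: balanced_empty)
next
  case (Suc i)
  have bal: "balanced (x ` {..<i})"
    using Suc by simp
  have "erasable (peel_upto (G, \<theta>) x i) (x i)"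
    using Suc.prems by simp
  then have "balanced (insert (x i) (x ` {..<i}))"
    using erasable_peel_upto_iff[of i x "x i"] Suc.prems bal
    by (intro balanced_insert) (auto simp: balanced_def order_less_le)
  then show ?case
    by (simp add: lessThan_Suc)
qed

text \<open>Induction on the size: a vertex whose removal keeps \<open>B\<close> balanced can be
  peeled last.\<close>

lemma balanced_peelable:
  assumes "balanced B"
  shows "\<exists>x k. B = x ` {..<k} \<and> (\<forall>i<k. erasable (peel_upto (G, \<theta>) x i) (x i))"
  using assms
proof (induction "card B" arbitrary: B)
  case 0
  then have "B = {}"
    by (auto simp: balanced_def)
  then show ?case
    by (intro exI[of _ undefined] exI[of _ 0]) simp
next
  case (Suc n)
  have fin: "finite B"
    using Suc.prems by (simp add: balanced_def)
  have "{} \<subset> B"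
    using Suc.hyps(2) by auto
  then obtain v where v: "v \<in> B" "balanced (B - {v})"
    by (rule balanced_subset_removable[OF balanced_empty Suc.prems]) simp
  have "n = card (B - {v})"
    using Suc.hyps(2) v(1) by simp
  then obtain x k where x: "B - {v} = x ` {..<k}"
    "\<And>i. i < k \<Longrightarrow> erasable (peel_upto (G, \<theta>) x i) (x i)"
    using Suc.hyps(1) v(2) by blast
  have eq: "out_count B v = \<theta> v"
    using balanced_remove_iff v Suc.prems by blast
  \<comment> \<open>Since \<open>z\<close> lies outside \<open>B\<close>, its count in
    \<open>B\<close> is at most \<open>\<theta> z\<close>; without \<open>v\<close> it is one
    less.\<close>
  have "\<theta> z \<noteq> out_count (B - {v}) z" if "z \<notin> B - {v}" "(z, v) \<in> parcs G" for z
  proof -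
    have "z \<notin> B"
      using that no_loop by auto
    then have "out_count B z \<le> \<theta> z"
      using Suc.prems by (simp add: balanced_def)
    then show ?thesis
      using out_count_remove[OF fin v(1), of z] that(2) by simp
  qed
  then have "erasable (peel_upto (G, \<theta>) x k) v"
    using erasable_peel_upto_iff[of k x v] x eq v(1) Suc.prems out_count_remove[OF fin v(1), of v] by (auto simp: balanced_def no_loop)
  moreover define y where "y = x(k := v)"
  moreover have "peel_upto (G, \<theta>) y i = peel_upto (G, \<theta>) x i" if "i \<le> k" for i
    using that by (intro peel_upto_cong) (auto simp: y_def)
  ultimately have "\<forall>i<Suc k. erasable (peel_upto (G, \<theta>) y i) (y i)"
    using x(2) by (auto simp: less_Suc_eq)
  moreover have "y ` {..<k} = x ` {..<k}"
    by (intro image_cong) (auto simp: y_def)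
  then have "B = y ` {..<Suc k}"
    using x(1) v(1) by (auto simp: lessThan_Suc y_def)
  ultimately show ?case
    by blast
qed

lemma IS_eq_balanced: "IS (G, \<theta>) = Collect balanced"
proof (intro set_eqI iffI)
  fix B
  assume "B \<in> IS (G, \<theta>)"
  then consider "B = {}" | x k n where "B = x ` {..<k}" "peeling_sequence (G, \<theta>) n x" "enat k \<le> n"
    unfolding IS_def by blast
  then show "B \<in> Collect balanced"
  proof cases
    case 1
    then show ?thesis by (simp add: balanced_empty)
  next
    case 2
    have "erasable (peel_upto (G, \<theta>) x j) (x j)" if "j < k" for j
      using 2(2,3) that less_le_trans[of "enat j" "enat k" n] by (auto simp: peeling_sequence_def)
    then show ?thesis
      using balanced_peeled 2(1) by simp
  qed
next
  fix B
  assume "B \<in> Collect balanced"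
  then obtain x k where x: "B = x ` {..<k}"
    "\<And>i. i < k \<Longrightarrow> erasable (peel_upto (G, \<theta>) x i) (x i)"
    using balanced_peelable by blast
  obtain y n where y: "peeling_sequence (G, \<theta>) n y" "enat k \<le> n" "\<forall>i<k. y i = x i"
    using peeling_sequence_extension[of k "(G, \<theta>)" x] x(2) by blast
  have B: "B = y ` {..<k}"
    unfolding x(1) using y(3) by (intro image_cong) auto
  show "B \<in> IS (G, \<theta>)"
  \<comment> \<open>The length \<open>k = 0\<close> falls under the separate clause of
    \<open>IS\<close> for \<open>{}\<close>.\<close>
  proof (cases "k = 0")
    case True
    then show ?thesis
      using x(1) by (simp add: IS_def)
  next
    case False
    then have "1 \<le> k"
      by simp
    then show ?thesis
      unfolding IS_def using y(1,2) B by blast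
  qed
qed

section \<open>Free vertices, atoms and joins\<close>

definition free :: "'a set \<Rightarrow> 'a set" where
  "free B = {x \<in> B. balanced (B - {x})}"

text \<open>These are the vertices \<open>x\<close> for which \<open>{x}\<close> is an atom of the
  poset.\<close>

definition atoms :: "'a set" where
  "atoms = {x. erasable (G, \<theta>) x}"

lemma atoms_iff: "x \<in> atoms \<longleftrightarrow> x \<in> pverts G \<and> \<theta> x = 0 \<and> (\<forall>z. (z, x) \<in> parcs G \<longrightarrow> \<theta> z \<noteq> 0)"
  by (simp add: atoms_def)

text \<open>The first vertex in a peeling of \<open>B\<close> is erasable from the start.\<close>

lemma ex_atom:
  assumes "balanced B" "B \<noteq> {}"
  shows "atoms \<inter> B \<noteq> {}"
proof -
  obtain x k where x: "B = x ` {..<k}" "\<forall>i<k. erasable (peel_upto (G, \<theta>) x i) (x i)"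
    using balanced_peelable assms(1) by blast
  then have "k > 0"
    using assms(2) by auto
  then have "erasable (peel_upto (G, \<theta>) x 0) (x 0)" "x 0 \<in> B"
    using x by auto
  then show ?thesis
    by (auto simp: atoms_def)
qed

text \<open>
  The join of \<open>X\<close> is obtained by adding a vertex \<open>z\<close> whenever more than \<open>\<theta> z\<close> of its
  out-neighbours are present. Membership thus always comes with a strict inequality, except
  for the elements of \<open>X\<close>, where the lower bound \<open>\<theta> z = 0\<close> is trivial.
\<close>

lemma least_balanced_superset:
  assumes A: "balanced A" and X: "X \<subseteq> atoms \<inter> A"
  obtains J where "balanced J" "X \<subseteq> J" "J \<subseteq> A"
    "\<And>C. balanced C \<Longrightarrow> X \<subseteq> C \<Longrightarrow> C \<subseteq> A \<Longrightarrow> J \<subseteq> C"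
proof -
  \<comment> \<open>\<open>closed\<close> keeps the half of balance that survives intersections, so
    there is a least closed set; outside \<open>X\<close> the other half is recovered from
    minimality.\<close>
  define closed where "closed C \<longleftrightarrow> X \<subseteq> C \<and> C \<subseteq> A \<and> (\<forall>z. \<theta> z < out_count C z \<longrightarrow> z \<in> C)" for C
  define J where "J = \<Inter> (Collect closed)"
  have balanced_closed: "closed C" if "balanced C" "X \<subseteq> C" "C \<subseteq> A" for C
    using that by (auto simp: closed_def balanced_def not_le[symmetric])
  have "closed A"
    using A X by (intro balanced_closed) auto
  then have sub: "X \<subseteq> J" "J \<subseteq> A"
    by (auto simp: J_def closed_def)
  have fin: "finite A"
    using A by (simp add: balanced_def)
  then have finJ: "finite J"
    using sub(2) finite_subset by blast
  have in_J: "z \<in> J" if z: "\<theta> z < out_count J z" for z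
    unfolding J_def
  proof (intro InterI)
    fix C
    assume "C \<in> Collect closed"
    then have C: "closed C" "J \<subseteq> C"
      by (auto simp: J_def)
    moreover have "out_count J z \<le> out_count C z"
      using C fin by (intro out_count_mono) (auto simp: closed_def intro: finite_subset)
    ultimately show "z \<in> C"
      using z by (simp add: closed_def)
  qed
  have "\<theta> z \<le> out_count J z" if z: "z \<in> J" for z
  proof (cases "z \<in> X")
    case True
    then show ?thesis
      using X atoms_iff by auto
  next
    case False
    show ?thesis
    proof (rule ccontr)
      assume "\<not> \<theta> z \<le> out_count J z"
      then have less: "out_count J z < \<theta> z"
        by simp
      \<comment> \<open>A vertex forced by \<open>J - {z}\<close> is forced by \<open>J\<close>, and
        it differs from \<open>z\<close>, whose count is below \<open>\<theta> z\<close>. So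
        \<open>J - {z}\<close> is closed, against minimality.\<close>
      have "w \<in> J - {z}" if w: "\<theta> w < out_count (J - {z}) w" for w
      proof -
        have "out_count (J - {z}) w \<le> out_count J w"
          using finJ by (intro out_count_mono) auto
        with w have "\<theta> w < out_count J w"
          by simp
        then show ?thesis
          using in_J less by (metis Diff_iff less_asym singletonD)
      qed
      then have "closed (J - {z})"
        using sub False by (auto simp: closed_def)
      then show False
        using z by (auto simp: J_def)
    qed
  qed
  moreover have "J \<subseteq> pverts G"
    using A sub by (auto simp: balanced_def)
  moreover have "out_count J z \<le> \<theta> z" if "z \<notin> J" for z
    using in_J that not_le by blast
  ultimately have "balanced J"
    using finJ by (simp add: balanced_def)
  moreover have "J \<subseteq> C" if "balanced C" "X \<subseteq> C" "C \<subseteq> A" for C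
    using balanced_closed[OF that] by (auto simp: J_def)
  ultimately show thesis
    using that sub by blast
qed

text \<open>The unique set is the join of \<open>X\<close>: a free vertex of the join outside
  \<open>X\<close> could be dropped, and any larger \<open>B\<close> has a free vertex outside the
  join.\<close>

lemma ex1_balanced_free_subset:
  assumes A: "balanced A" and X: "X \<subseteq> atoms \<inter> A"
  shows "\<exists>J. {B. balanced B \<and> B \<subseteq> A \<and> X \<subseteq> B \<and> free B \<subseteq> X} = {J}"
proof -
  obtain J where J: "balanced J" "X \<subseteq> J" "J \<subseteq> A"
    and least: "\<And>C. balanced C \<Longrightarrow> X \<subseteq> C \<Longrightarrow> C \<subseteq> A \<Longrightarrow> J \<subseteq> C"
    using least_balanced_superset[OF assms] by blast
  have "free J \<subseteq> X"
  proof
    fix x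
    assume "x \<in> free J"
    then show "x \<in> X"
      using least[of "J - {x}"] J by (auto simp: free_def)
  qed
  moreover have "B = J" if B: "balanced B" "B \<subseteq> A" "X \<subseteq> B" "free B \<subseteq> X" for B
  proof (rule ccontr)
    assume "B \<noteq> J"
    then have "J \<subset> B"
      using least B by blast
    then obtain x where "x \<in> B - J" "balanced (B - {x})"
      using balanced_subset_removable J(1) B(1) by blast
    then show False
      using B(4) J(2) by (auto simp: free_def)
  qed
  ultimately show ?thesis
    using J by (intro exI[of _ J]) blast
qed

section \<open>The crosscut sum and the Moebius function\<close>

definition crosscut :: "'a set \<Rightarrow> int" where
  "crosscut B = (\<Sum>X | free B \<subseteq> X \<and> X \<subseteq> atoms \<inter> B. (-1) ^ card X)"

text \<open>After exchanging the sums, each set of atoms below \<open>A\<close> is counted once, at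
  its join. What remains is the alternating sum over all subsets of the nonempty set
  \<open>atoms \<inter> A\<close>.\<close>

lemma sum_crosscut:
  assumes A: "balanced A" "A \<noteq> {}"
  shows "(\<Sum>B | balanced B \<and> B \<subseteq> A. crosscut B) = 0"
proof -
  have fin: "finite A"
    using A by (simp add: balanced_def)
  have finB: "finite {B. balanced B \<and> B \<subseteq> A}"
    using fin by (auto intro: finite_subset[of _ "Pow A"])
  have finX: "finite (Pow (atoms \<inter> A))"
    using fin by simp
  have "(\<Sum>B | balanced B \<and> B \<subseteq> A. crosscut B) =
    (\<Sum>B | balanced B \<and> B \<subseteq> A. \<Sum>X | X \<in> Pow (atoms \<inter> A) \<and> (X \<subseteq> B \<and> free B \<subseteq> X). (-1) ^ card X)"
    unfolding crosscut_def by (intro sum.cong refl) blast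
  also have "\<dots> = (\<Sum>X\<in>Pow (atoms \<inter> A).
      \<Sum>B | B \<in> {B. balanced B \<and> B \<subseteq> A} \<and> (X \<subseteq> B \<and> free B \<subseteq> X). (-1) ^ card X)"
    by (rule sum.swap_restrict[OF finB finX])
  also have "\<dots> = (\<Sum>X\<in>Pow (atoms \<inter> A). (-1) ^ card X)"
  proof (intro sum.cong refl)
    fix X
    assume "X \<in> Pow (atoms \<inter> A)"
    then have "X \<subseteq> atoms \<inter> A"
      by (rule PowD)
    then have "\<exists>J. {B. balanced B \<and> B \<subseteq> A \<and> X \<subseteq> B \<and> free B \<subseteq> X} = {J}"
      by (rule ex1_balanced_free_subset[OF A(1)])
    then obtain J where "{B. balanced B \<and> B \<subseteq> A \<and> X \<subseteq> B \<and> free B \<subseteq> X} = {J}" ..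
    then have "{B. B \<in> {B. balanced B \<and> B \<subseteq> A} \<and> (X \<subseteq> B \<and> free B \<subseteq> X)} = {J}"
      by (simp only: mem_Collect_eq conj_assoc)
    then show "(\<Sum>B | B \<in> {B. balanced B \<and> B \<subseteq> A} \<and> (X \<subseteq> B \<and> free B \<subseteq> X). (-1) ^ card X) =
      ((-1) ^ card X :: int)"
      by simp
  qed
  also have "\<dots> = 0"
    using sum_alternating_interval[of "atoms \<inter> A" "{}"] fin ex_atom[OF A] by (auto simp: Pow_def)
  finally show ?thesis .
qed

text \<open>Both sides are 1 at \<open>{}\<close> and sum to 0 over the balanced subsets of a
  nonempty \<open>A\<close>, which determines them inductively.\<close>

lemma moebius_eq_crosscut:
  assumes "balanced A"
  shows "moebius (Collect balanced) {} A = crosscut A"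
  using assms
proof (induction "card A" arbitrary: A rule: less_induct)
  case less
  have fin: "finite A"
    using less.prems by (simp add: balanced_def)
  show ?case
  proof (cases "A = {}")
    case True
    then show ?thesis
      using sum_alternating_interval[of "{}" "free {}"]
      by (simp add: moebius_refl balanced_empty crosscut_def free_def)
  next
    case False
    let ?P = "{B. balanced B \<and> B \<subseteq> A}" and ?Q = "{B. balanced B \<and> B \<subset> A}"
    have finP: "finite ?P"
      using fin by (auto intro: finite_subset[of _ "Pow A"])
    have P: "?P = insert A ?Q"
      using less.prems by auto
    have finQ: "finite ?Q"
      using finP unfolding P by simp
    have "(\<Sum>B\<in>?P. moebius (Collect balanced) {} B) = 0"
      using moebius_sum_eq_0[of "{}" "Collect balanced" A] less.prems False balanced_empty finP by auto
    also have "0 = (\<Sum>B\<in>?P. crosscut B)"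
      using sum_crosscut[OF less.prems False] by simp
    finally have "moebius (Collect balanced) {} A + (\<Sum>B\<in>?Q. moebius (Collect balanced) {} B) =
        crosscut A + (\<Sum>B\<in>?Q. crosscut B)"
      using finQ unfolding P by simp
    moreover have "(\<Sum>B\<in>?Q. moebius (Collect balanced) {} B) = (\<Sum>B\<in>?Q. crosscut B)"
      using less.hyps fin by (intro sum.cong) (auto intro: psubset_card_mono)
    ultimately show ?thesis
      by simp
  qed
qed

section \<open>Free vertices, atoms and vertices of value 0\<close>

lemma free_eq_zero_imp_atoms:
  assumes A: "balanced A" and eq: "free A = {x \<in> A. \<theta> x = 0}"
  shows "free A = atoms \<inter> A"
proof
  show "atoms \<inter> A \<subseteq> free A"
    unfolding eq by (auto simp: atoms_iff)
  show "free A \<subseteq> atoms \<inter> A"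
  proof
    fix x
    assume x: "x \<in> free A"
    then have "x \<in> A"
      by (simp add: free_def)
    \<comment> \<open>An in-neighbour \<open>z\<close> of value 0 would lie in \<open>A\<close> by
      balance and be free by \<open>eq\<close>; but \<open>x\<close> remains in
      \<open>A - {z}\<close>, so the count of \<open>z\<close> there exceeds 0.\<close>
    have "\<theta> z \<noteq> 0" if z: "(z, x) \<in> parcs G" for z
    proof
      assume "\<theta> z = 0"
      have "x \<noteq> z" "finite A"
        using z no_loop A by (auto simp: balanced_def)
      then have pos: "out_count A z \<noteq> 0" "out_count (A - {z}) z \<noteq> 0"
        using x z by (auto simp: out_count_eq_0_iff free_def)
      have "\<not> balanced (A - {z})"
        using pos(2) \<open>\<theta> z = 0\<close> by (auto simp: balanced_def)
      moreover have "z \<in> A"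
        using A pos(1) \<open>\<theta> z = 0\<close> by (auto simp: balanced_def)
      ultimately show False
        using eq \<open>\<theta> z = 0\<close> by (auto simp: free_def)
    qed
    moreover have "\<theta> x = 0" "x \<in> pverts G"
      using x A eq by (auto simp: balanced_def)
    ultimately show "x \<in> atoms \<inter> A"
      using \<open>x \<in> A\<close> by (simp add: atoms_iff)
  qed
qed

text \<open>Take a source \<open>x\<close> among the vertices of value 0 in \<open>A\<close> that
  are not atoms. Its in-neighbour \<open>z\<close> of value 0 lies in \<open>A\<close>, so it is an
  atom and hence free; but freeness forces \<open>out_count A z = 0\<close>, although
  \<open>x\<close> is counted.\<close>

lemma free_eq_atoms_imp_zero:
  assumes A: "balanced A" and eq: "free A = atoms \<inter> A"
  shows "free A = {x \<in> A. \<theta> x = 0}"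
proof (rule ccontr)
  assume neq: "free A \<noteq> {x \<in> A. \<theta> x = 0}"
  have fin: "finite A"
    using A by (simp add: balanced_def)
  define T where "T = {x \<in> A. \<theta> x = 0} - atoms"
  have "T \<noteq> {}"
    using neq unfolding eq T_def by (auto simp: atoms_iff)
  then obtain x where x: "x \<in> T" "\<And>z. z \<in> T \<Longrightarrow> (z, x) \<notin> parcs G"
    using finite_acyclic_source[OF acyclic, of T] fin by (auto simp: T_def)
  then obtain z where z: "(z, x) \<in> parcs G" "\<theta> z = 0"
    using A by (auto simp: T_def balanced_def atoms_iff)
  have nonzero: "out_count A z \<noteq> 0"
    using fin x(1) z(1) by (auto simp: T_def out_count_eq_0_iff)
  then have "z \<in> A"
    using A z(2) by (auto simp: balanced_def)
  then have "z \<in> free A"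
    unfolding eq using x(2) z by (auto simp: T_def)
  then have "out_count A z = \<theta> z"
    using balanced_remove_iff[OF A] by (auto simp: free_def)
  then show False
    using nonzero z(2) by simp
qed

lemma moebius_balanced:
  assumes A: "balanced A"
  shows "moebius (Collect balanced) {} A =
    (if free A = {x \<in> A. \<theta> x = 0} then (-1) ^ card {x \<in> A. \<theta> x = 0} else 0)"
proof -
  have fin: "finite A"
    using A by (simp add: balanced_def)
  have moebius: "moebius (Collect balanced) {} A =
      (if free A = atoms \<inter> A then (-1) ^ card (atoms \<inter> A) else 0)"
    unfolding moebius_eq_crosscut[OF A] crosscut_def
    using fin by (intro sum_alternating_interval) auto
  show ?thesis
  proof (cases "free A = atoms \<inter> A")
    case True
    then have "{x \<in> A. \<theta> x = 0} = free A"
      by (rule free_eq_atoms_imp_zero[OF A, symmetric])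
    then show ?thesis
      using moebius True by (simp only: if_True simp_thms)
  next
    case False
    then have "free A \<noteq> {x \<in> A. \<theta> x = 0}"
      by (rule contrapos_nn) (rule free_eq_zero_imp_atoms[OF A])
    then show ?thesis
      using moebius False by (simp only: if_False)
  qed
qed

end

theorem theorem2:
  fixes G :: "'a pair_pre_digraph" and \<theta> :: "'a \<Rightarrow> nat" and A :: "'a set"
  assumes "is_valued_digraph (G, \<theta>)"
    and "A \<in> IS (G, \<theta>)"
  shows "moebius (IS (G, \<theta>)) {} A =
    (if free_vertices (G, \<theta>) A = zero_vertices (G, \<theta>) A
     then (-1) ^ card (zero_vertices (G, \<theta>) A) else 0)"
proof -
  interpret acyclic_valued_digraph G \<theta>
    using assms(1) by (intro acyclic_valued_digraph.intro) simp_all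
  show ?thesis
    using moebius_balanced assms(2)
    by (simp add: IS_eq_balanced free_def free_vertices_def zero_vertices_def)
qed

end
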